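(* For every fixed $n$ and $m$, every deterministic non-preemptive online algorithm for minimizing total flow time on $m$ identical parallel machines has competitive ratio at least $\Gamma(n,m)$, where $\Gamma(n,m)=\Omega\!\left(n/m^2+\sqrt{n/m}\right)$.
   Context: Online scheduling of jobs on $m$ identical machines; each job $j$ has release time $r_j\ge0$ and processing time $p_j>0$, becomes known only at $r_j$, and the algorithm knows $n$ (the number of jobs) and $m$. Each machine processes at most one job at a time; non-preemptive means a started job runs to completion without interruption. Flow time of $j$ is $C_j-r_j$; objective is total flow time. For this lower bound, $\mathrm{OPT}(J)$ is the minimum total flow time over offline non-preemptive schedules. Competitive ratio at least $\Gamma$ means that for some instance with (at most) $n$ jobs the algorithm's total flow time is at least a constant times $\Gamma\cdot\mathrm{OPT}(J)$. *)

theory Defs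
  imports Complex_Main
begin

datatype job = Job (release: real) (ptime: real)

text \<open>
  A job is identified by its position in the list. Jobs are listed in order of arrival, so that
  the positions of the jobs released so far carry no information about later jobs.
\<close>

definition instances :: "nat \<Rightarrow> job list set" where
  "instances n = {J. length J = n \<and> sorted (map release J) \<and>
                     (\<forall>x\<in>set J. 0 \<le> release x \<and> 0 < ptime x)}"

text \<open>
  A non-preemptive schedule is determined by the machine and the starting time of each job.
\<close>

datatype schedule = Schedule (machine: "nat \<Rightarrow> nat") (start: "nat \<Rightarrow> real")

definition completion :: "job list \<Rightarrow> schedule \<Rightarrow> nat \<Rightarrow> real" where
  "completion J \<sigma> j = start \<sigma> j + ptime (J ! j)"

definition feasible :: "nat \<Rightarrow> job list \<Rightarrow> schedule \<Rightarrow> bool" where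
  "feasible m J \<sigma> \<longleftrightarrow>
     (\<forall>j<length J. machine \<sigma> j < m \<and> release (J ! j) \<le> start \<sigma> j) \<and>
     (\<forall>i<length J. \<forall>j<length J. i \<noteq> j \<and> machine \<sigma> i = machine \<sigma> j \<longrightarrow>
        {start \<sigma> i ..< completion J \<sigma> i} \<inter> {start \<sigma> j ..< completion J \<sigma> j} = {})"

definition total_flow_time :: "job list \<Rightarrow> schedule \<Rightarrow> real" where
  "total_flow_time J \<sigma> = (\<Sum>j<length J. completion J \<sigma> j - release (J ! j))"

text \<open>
  For \<open>m \<ge> 1\<close> the infimum is over a nonempty set bounded below, and it is attained: only
  finitely many combinations of a machine assignment and an order on each machine exist, and for
  each of them starting every job as early as possible is best.
\<close>

definition OPT :: "nat \<Rightarrow> job list \<Rightarrow> real" where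
  "OPT m J = (INF \<sigma>\<in>{\<sigma>. feasible m J \<sigma>}. total_flow_time J \<sigma>)"

definition released_by :: "real \<Rightarrow> job list \<Rightarrow> job list" where
  "released_by t J = filter (\<lambda>x. release x \<le> t) J"

text \<open>
  A deterministic online algorithm is a map from instances to schedules that does not look ahead:
  whatever it has started up to time \<open>t\<close> is a function of the jobs released up to time \<open>t\<close>.
  The parameters \<open>n\<close> and \<open>m\<close> are fixed, so the algorithm may depend on them. Only
  instances with exactly \<open>n\<close> jobs are compared, so the number of jobs is known in advance.
\<close>

definition online_algorithm :: "nat \<Rightarrow> nat \<Rightarrow> (job list \<Rightarrow> schedule) \<Rightarrow> bool" where
  "online_algorithm n m A \<longleftrightarrow>
     (\<forall>J\<in>instances n. feasible m J (A J)) \<and>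
     (\<forall>J\<in>instances n. \<forall>J'\<in>instances n. \<forall>t. released_by t J = released_by t J' \<longrightarrow>
        (\<forall>j<n. start (A J) j \<le> t \<longrightarrow>
           start (A J') j = start (A J) j \<and> machine (A J') j = machine (A J) j))"

definition competitive_ratio_at_least ::
    "nat \<Rightarrow> nat \<Rightarrow> (job list \<Rightarrow> schedule) \<Rightarrow> real \<Rightarrow> bool" where
  "competitive_ratio_at_least n m A \<rho> \<longleftrightarrow>
     (\<exists>J\<in>instances n. total_flow_time J (A J) \<ge> \<rho> * OPT m J)"

end

theory Submission
  imports Defs
begin

text \<open>
  Release \<open>m\<close> long jobs (of size 3) at time 0. Either at least half of them start after time
  \<open>T = \<lceil>max (n / m\<^sup>2) (sqrt (n / m))\<rceil>\<close>, which costs \<open>m T / 2\<close>, or some unit interval before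
  \<open>T\<close> contains \<open>k \<ge> max 1 (m / (2 T))\<close> of their starts. Shortly after that interval a stream
  of tiny jobs arrives for one time unit at a rate that saturates all \<open>m\<close> machines. As \<open>k\<close>
  machines are blocked, the backlog grows at \<open>k / m\<close> times the rate of the stream, and about
  \<open>n\<close> tiny jobs pay \<open>\<Omega>(k n / m)\<close> in total. Offline, the long jobs can be run before or after
  the stream, at a total cost \<open>O(m)\<close>.
\<close>

section \<open>The family of instances\<close>

text \<open>
  Jobs \<open>j < m\<close> are long. The stream consists of \<open>L\<close> rounds of \<open>m\<close> jobs: job \<open>j\<close> belongs to the
  round \<open>j div m \<in> {1..L}\<close>, and round \<open>i\<close> arrives at time \<open>t + (i - 1) / L\<close>. Instances have exactly
  \<open>n\<close> jobs, so the remaining ones arrive after \<open>D\<close>, spread out and with total size at most 1.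
\<close>

definition arrival :: "nat \<Rightarrow> real \<Rightarrow> nat \<Rightarrow> real \<Rightarrow> nat \<Rightarrow> real" where
  "arrival m D L t j =
     (if j < m then 0 else if j < m + m * L then t + (real (j div m) - 1) / real L else D + real j)"

definition work :: "nat \<Rightarrow> nat \<Rightarrow> nat \<Rightarrow> nat \<Rightarrow> real" where
  "work n m L j = (if j < m then 3 else if j < m + m * L then 1 / real L else 1 / real n)"

definition stream_instance :: "nat \<Rightarrow> nat \<Rightarrow> real \<Rightarrow> nat \<Rightarrow> real \<Rightarrow> job list" where
  "stream_instance n m D L t = map (\<lambda>j. Job (arrival m D L t j) (work n m L j)) [0..<n]"

lemma length_stream_instance [simp]: "length (stream_instance n m D L t) = n"
  by (simp add: stream_instance_def)

lemma release_stream_instance [simp]: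
  "j < n \<Longrightarrow> release (stream_instance n m D L t ! j) = arrival m D L t j"
  by (simp add: stream_instance_def)

lemma ptime_stream_instance [simp]:
  "j < n \<Longrightarrow> ptime (stream_instance n m D L t ! j) = work n m L j"
  by (simp add: stream_instance_def)

lemma round_bounds:
  fixes m j L :: nat
  assumes "m \<le> j" "j < m + m * L" "m \<ge> 1"
  shows "1 \<le> j div m" "j div m \<le> L" "L \<ge> 1"
proof -
  show 1: "1 \<le> j div m"
    using assms div_le_mono[of m j m] by simp
  have "j < Suc L * m" using assms by (simp add: algebra_simps)
  then show 2: "j div m \<le> L"
    using less_mult_imp_div_less by (metis less_Suc_eq_le)
  show "L \<ge> 1" using 1 2 by simp
qed

text \<open>The last round arrives at \<open>t + 1 - 1 / L\<close>, so a tiny job started on arrival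
  is done within the window from \<open>t\<close> to \<open>t + 1\<close>.\<close>

lemma arrival_stream_bounds:
  assumes "m \<le> j" "j < m + m * L" "m \<ge> 1"
  shows "t \<le> arrival m D L t j" "arrival m D L t j + 1 / real L \<le> t + 1"
proof -
  note b = round_bounds[OF assms]
  show "t \<le> arrival m D L t j"
    using assms b by (simp add: arrival_def)
  have "(real (j div m) - 1) / real L + 1 / real L = real (j div m) / real L"
    by (simp add: diff_divide_distrib)
  also have "\<dots> \<le> 1" using b by (simp add: divide_le_eq)
  finally show "arrival m D L t j + 1 / real L \<le> t + 1"
    using assms by (simp add: arrival_def)
qed

lemma arrival_mono:
  assumes "i \<le> j" "m \<ge> 1" "0 \<le> t" "t + 1 \<le> D"
  shows "arrival m D L t i \<le> arrival m D L t j"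
proof -
  consider "j < m" | "i < m" "m \<le> j" "j < m + m * L" | "i < m" "m + m * L \<le> j"
    | "m \<le> i" "j < m + m * L" | "m \<le> i" "i < m + m * L" "m + m * L \<le> j" | "m + m * L \<le> i"
    by linarith
  then show ?thesis
  proof cases
    case 2
    with arrival_stream_bounds(1)[of m j L t D] assms show ?thesis by (simp add: arrival_def)
  next
    case 4
    have "real (i div m) \<le> real (j div m)" using assms by (simp add: div_le_mono)
    then have "(real (i div m) - 1) / real L \<le> (real (j div m) - 1) / real L"
      by (intro divide_right_mono) auto
    with 4 assms show ?thesis by (simp add: arrival_def)
  next
    case 5
    have "0 \<le> 1 / real L" by simp
    with 5 arrival_stream_bounds(2)[of m i L D t] assms
    have "arrival m D L t i \<le> D" by (smt (verit))
    with 5 show ?thesis by (simp add: arrival_def)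
  qed (use assms in \<open>auto simp: arrival_def\<close>)
qed

lemma work_pos:
  assumes "m \<ge> 1" "n \<ge> 1"
  shows "0 < work n m L j"
  using assms round_bounds(3)[of m j L] by (auto simp: work_def)

lemma stream_instance_in_instances:
  assumes "m \<ge> 1" "n \<ge> 1" "0 \<le> t" "t + 1 \<le> D"
  shows "stream_instance n m D L t \<in> instances n"
proof -
  have "sorted (map release (stream_instance n m D L t))"
    by (auto simp: sorted_iff_nth_mono intro!: arrival_mono assms)
  moreover have "0 \<le> arrival m D L t j" for j
    using arrival_mono[of 0 j m t D L] assms by (simp add: arrival_def)
  ultimately show ?thesis
    using work_pos[OF assms(1,2)] by (auto simp: instances_def stream_instance_def)
qed

text \<open>The right-hand side mentions none of \<open>L\<close>, \<open>t\<close>,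
  \<open>D\<close>: until the stream and the fillers arrive, all these instances look alike, so an
  online algorithm acts alike on the ones with and without a stream.\<close>

lemma released_by_stream_instance:
  assumes "m \<ge> 1" "0 \<le> u" "L = 0 \<or> u < t" "u < D"
  shows "released_by u (stream_instance n m D L t)
           = map (\<lambda>_. Job 0 3) (filter (\<lambda>j. j < m) [0..<n])"
proof -
  have "arrival m D L t j \<le> u \<longleftrightarrow> j < m" for j
    using arrival_stream_bounds(1)[of m j L t D] assms by (auto simp: arrival_def)
  then have "released_by u (stream_instance n m D L t)
      = map (\<lambda>j. Job (arrival m D L t j) (work n m L j)) (filter (\<lambda>j. j < m) [0..<n])"
    by (simp add: released_by_def stream_instance_def filter_map o_def)
  also have "\<dots> = map (\<lambda>_. Job 0 3) (filter (\<lambda>j. j < m) [0..<n])"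
    by (rule map_cong) (auto simp: arrival_def work_def)
  finally show ?thesis .
qed

section \<open>Flow times, the optimum and the competitive ratio\<close>

lemma flow_time_nonneg:
  assumes "J \<in> instances n" "feasible m J \<sigma>" "j < n"
  shows "0 \<le> completion J \<sigma> j - release (J ! j)"
proof -
  have "J ! j \<in> set J" using assms by (simp add: instances_def)
  then have "0 < ptime (J ! j)" using assms by (auto simp: instances_def)
  moreover have "release (J ! j) \<le> start \<sigma> j"
    using assms by (auto simp: feasible_def instances_def)
  ultimately show ?thesis by (simp add: completion_def)
qed

lemma total_flow_time_ge_sum:
  assumes "J \<in> instances n" "feasible m J \<sigma>" "S \<subseteq> {..<n}"
  shows "(\<Sum>j\<in>S. completion J \<sigma> j - release (J ! j)) \<le> total_flow_time J \<sigma>"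
proof -
  have "length J = n" using assms by (simp add: instances_def)
  then show ?thesis
    unfolding total_flow_time_def
    using flow_time_nonneg[OF assms(1,2)] assms(3) by (intro sum_mono2) auto
qed

lemma OPT_le:
  assumes "J \<in> instances n" "feasible m J \<sigma>"
  shows "OPT m J \<le> total_flow_time J \<sigma>"
proof -
  have "bdd_below (total_flow_time J ` {\<sigma>. feasible m J \<sigma>})"
    using total_flow_time_ge_sum[OF assms(1), of m _ "{}"] by (intro bdd_belowI[of _ 0]) auto
  then show ?thesis unfolding OPT_def using assms by (intro cINF_lower) auto
qed

text \<open>Any feasible schedule of cost at most \<open>B\<close> bounds the optimum from above, so
  \<open>OPT\<close> never has to be computed.\<close>

lemma competitive_ratioI:
  assumes "J \<in> instances n" "feasible m J \<sigma>" "total_flow_time J \<sigma> \<le> B"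
    and "0 \<le> \<rho>" "\<rho> * B \<le> total_flow_time J (A J)"
  shows "competitive_ratio_at_least n m A \<rho>"
proof -
  have "\<rho> * OPT m J \<le> \<rho> * B"
    using OPT_le[OF assms(1,2)] assms by (intro mult_left_mono) auto
  then show ?thesis using assms unfolding competitive_ratio_at_least_def by force
qed

section \<open>Offline cost of the instances\<close>

text \<open>Each round puts one job on every machine and ends when the next round arrives, so the
  stream costs \<open>m * L * (1 / L)\<close>, at most \<open>m\<close>. A long job waits at most 3
  and runs for 3, giving \<open>6 * m\<close>. The fillers are one time unit apart and at most that
  long, so one machine serves them on arrival, at cost at most 1.\<close>

lemma stream_instance_cheap:
  assumes "1 \<le> m" "m + m * L \<le> n" "t = 2 \<or> 3 \<le> t" "t + 1 \<le> D" "6 \<le> D"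
  shows "\<exists>\<sigma>. feasible m (stream_instance n m D L t) \<sigma> \<and>
              total_flow_time (stream_instance n m D L t) \<sigma> \<le> 8 * real m"
proof -
  let ?J = "stream_instance n m D L t"
  let ?a = "arrival m D L t"
  \<comment> \<open>With \<open>t = 2\<close> the stream would collide with long jobs started at \<open>0\<close>, so these wait for its end.\<close>
  define s :: real where "s = (if t = 2 then 3 else 0)"
  define \<sigma> where "\<sigma> = Schedule (\<lambda>j. if j < m + m * L then j mod m else 0)
                                (\<lambda>j. if j < m then s else ?a j)"
  have n1: "1 \<le> n" using assms by (simp add: order.trans)
  have comp: "completion ?J \<sigma> j = start \<sigma> j + work n m L j" if "j < n" for j
    using that by (simp add: completion_def)
  have sep: "completion ?J \<sigma> i \<le> start \<sigma> j \<or> completion ?J \<sigma> j \<le> start \<sigma> i"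
    if ij: "i < j" "j < n" "machine \<sigma> i = machine \<sigma> j" for i j
  proof -
    have c: "completion ?J \<sigma> i = start \<sigma> i + work n m L i"
      "completion ?J \<sigma> j = start \<sigma> j + work n m L j" using comp ij by auto
    consider "j < m" | "i < m" "m \<le> j" "j < m + m * L" | "i < m" "m + m * L \<le> j"
      | "m \<le> i" "j < m + m * L" | "m \<le> i" "i < m + m * L" "m + m * L \<le> j" | "m + m * L \<le> i"
      by linarith
    then show ?thesis
    proof cases
      case 1
      then show ?thesis using ij by (simp add: \<sigma>_def)
    next
      case 2
      then show ?thesis
        using c assms arrival_stream_bounds(1)[of m j L t D]
          arrival_stream_bounds(2)[of m j L D t]
        by (auto simp: \<sigma>_def s_def work_def)
    next
      case 3
      then show ?thesis using c assms by (auto simp: \<sigma>_def s_def work_def arrival_def)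
    next
      case 4
      have "i mod m = j mod m" using ij 4 by (simp add: \<sigma>_def)
      then have "i div m \<noteq> j div m" using ij(1) by (metis div_mult_mod_eq less_irrefl)
      moreover have "i div m \<le> j div m" using ij by (simp add: div_le_mono)
      ultimately have "real (i div m) \<le> real (j div m) - 1" by linarith
      then have "(real (i div m) - 1) / real L + 1 / real L \<le> (real (j div m) - 1) / real L"
        by (simp add: divide_right_mono flip: add_divide_distrib)
      then show ?thesis using c ij 4 by (simp add: \<sigma>_def work_def arrival_def)
    next
      case 5
      then show ?thesis
        using c assms arrival_stream_bounds(2)[of m i L D t]
        by (auto simp: \<sigma>_def work_def arrival_def)
    next
      case 6
      have "1 / real n \<le> 1" "real i + 1 \<le> real j" using n1 ij by auto
      then have "real i + 1 / real n \<le> real j" by linarith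
      then show ?thesis using c ij 6 by (simp add: \<sigma>_def work_def arrival_def)
    qed
  qed
  have disj: "{start \<sigma> i ..< completion ?J \<sigma> i} \<inter> {start \<sigma> j ..< completion ?J \<sigma> j} = {}"
    if "i < n" "j < n" "i \<noteq> j" "machine \<sigma> i = machine \<sigma> j" for i j
    using that sep[of i j] sep[of j i] by (cases i j rule: linorder_cases) auto
  have "feasible m ?J \<sigma>"
    unfolding feasible_def
  proof (intro conjI allI impI)
    fix j assume "j < length ?J"
    then show "machine \<sigma> j < m" "release (?J ! j) \<le> start \<sigma> j"
      using assms by (auto simp: \<sigma>_def s_def arrival_def)
  qed (use disj in auto)
  moreover have "total_flow_time ?J \<sigma> \<le> 8 * real m"
  proof -
    have "total_flow_time ?J \<sigma> = (\<Sum>j<n. start \<sigma> j + work n m L j - ?a j)"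
      by (simp add: total_flow_time_def comp)
    also have "\<dots> \<le> (\<Sum>j<n. (if j \<in> {..<m} then 6 else 0)
                        + (if j \<in> {m..<m + m * L} then 1 / real L else 0) + 1 / real n)"
      by (rule sum_mono) (auto simp: \<sigma>_def s_def work_def arrival_def)
    also have "\<dots> = real m * 6 + real (m * L) * (1 / real L) + real n * (1 / real n)"
    proof -
      have "{..<n} \<inter> {..<m} = {..<m}" "{..<n} \<inter> {m..<m + m * L} = {m..<m + m * L}"
        using assms(2) by auto
      then show ?thesis
        by (simp only: sum.distrib finite_lessThan sum_constant card_lessThan card_atLeastLessThan
              add_diff_cancel_left' flip: sum.inter_restrict)
    qed
    also have "\<dots> \<le> 8 * real m" using assms n1 by (cases "L = 0") auto
    finally show ?thesis .
  qed
  ultimately show ?thesis by blast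
qed

section \<open>Online cost of a stream that meets blocked machines\<close>

text \<open>Applied to a flow time in units of \<open>1 / L\<close>, this bounds the number of grid
  times at which a job is still unfinished.\<close>

lemma card_less_between:
  fixes x :: real
  assumes "0 \<le> x"
  shows "real (card {i::nat. a < i \<and> real i < real a + x}) \<le> x"
proof -
  have "{i::nat. a < i \<and> real i < real a + x} \<subseteq> {a<..a + nat \<lfloor>x\<rfloor>}"
  proof safe
    fix i :: nat assume "a < i" "real i < real a + x"
    then have "int i - int a \<le> \<lfloor>x\<rfloor>" by (simp add: le_floor_iff)
    then show "i \<in> {a<..a + nat \<lfloor>x\<rfloor>}" using \<open>a < i\<close> by auto
  qed
  then have "card {i::nat. a < i \<and> real i < real a + x} \<le> nat \<lfloor>x\<rfloor>"
    using card_mono[of "{a<..a + nat \<lfloor>x\<rfloor>}"] by force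
  then show ?thesis using assms by linarith
qed

text \<open>A capacity count: a machine running a job of \<open>K\<close> is busy throughout the
  window from \<open>t\<close> to \<open>t + 1\<close>, and each other machine has room for at most
  \<open>i\<close> jobs of size \<open>1 / L\<close> between \<open>t\<close> and
  \<open>t + i / L\<close>.\<close>

lemma stream_completed_bound:
  assumes J: "J = stream_instance n m D L t" and f: "feasible m J \<sigma>"
    and "1 \<le> m" "1 \<le> L" "m + m * L \<le> n" "i \<le> L"
    and K: "K \<subseteq> {..<m}" "\<And>j. j \<in> K \<Longrightarrow> start \<sigma> j \<le> t \<and> t + 1 \<le> start \<sigma> j + 3"
  shows "card {j\<in>{m..<m + m * i}. completion J \<sigma> j \<le> t + real i / real L} \<le> (m - card K) * i"
proof -
  let ?Q = "{j\<in>{m..<m + m * i}. completion J \<sigma> j \<le> t + real i / real L}"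
  have iL: "m * i \<le> m * L" using assms by simp
  have disj: "{start \<sigma> i ..< completion J \<sigma> i} \<inter> {start \<sigma> j ..< completion J \<sigma> j} = {}"
    if "i < n" "j < n" "i \<noteq> j" "machine \<sigma> i = machine \<sigma> j" for i j
    using f that unfolding feasible_def J by auto
  have mach: "machine \<sigma> j < m" and rel: "arrival m D L t j \<le> start \<sigma> j" if "j < n" for j
    using f that unfolding feasible_def J by auto
  have compK: "completion J \<sigma> j = start \<sigma> j + 3" "j < n" if "j \<in> K" for j
    using that K(1) assms by (auto simp: completion_def J work_def)
  have Q: "j < n" "t \<le> start \<sigma> j" "completion J \<sigma> j = start \<sigma> j + 1 / real L"
    "start \<sigma> j + 1 / real L \<le> t + real i / real L" if "j \<in> ?Q" for j
  proof -
    have "m \<le> j" "j < m + m * i" using that by auto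
    with iL have j: "m \<le> j" "j < m + m * L" by linarith+
    then have "j < n" using assms by linarith
    note j = j this
    then show "j < n" by simp
    show "t \<le> start \<sigma> j"
      using arrival_stream_bounds(1)[OF j(1,2) \<open>1 \<le> m\<close>] rel[OF j(3)] by (rule order.trans)
    show *: "completion J \<sigma> j = start \<sigma> j + 1 / real L"
      using j by (simp add: completion_def J work_def)
    show "start \<sigma> j + 1 / real L \<le> t + real i / real L"
      using that * by simp
  qed
  have injK: "inj_on (machine \<sigma>) K"
  proof (rule inj_onI, rule ccontr)
    fix p q assume pq: "p \<in> K" "q \<in> K" "machine \<sigma> p = machine \<sigma> q" "p \<noteq> q"
    then have "t \<in> {start \<sigma> p ..< completion J \<sigma> p} \<inter> {start \<sigma> q ..< completion J \<sigma> q}"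
      using K(2)[of p] K(2)[of q] compK by auto
    then show False using disj[of p q] pq compK by auto
  qed
  have KM: "machine \<sigma> ` K \<subseteq> {..<m}" using mach compK by auto
  \<comment> \<open>Counting is done by an injection into pairs of a free machine and a grid
    interval of length \<open>1 / L\<close>, so the order of the jobs on a machine need not be
    described.\<close>
  define slot where "slot j = nat \<lfloor>(start \<sigma> j - t) * real L\<rfloor>" for j
  have slot: "real (slot j) \<le> (start \<sigma> j - t) * real L" "(start \<sigma> j - t) * real L < real (slot j) + 1"
    if "j \<in> ?Q" for j
    using Q(2)[OF that] unfolding slot_def by (auto simp: of_nat_nat)
  \<comment> \<open>Jobs of size \<open>1 / L\<close> on one machine start at least \<open>1 / L\<close> apart, hence in different slots.\<close>
  have "inj_on (\<lambda>j. (machine \<sigma> j, slot j)) ?Q"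
  proof (rule inj_onI, rule ccontr)
    fix p q assume pq: "p \<in> ?Q" "q \<in> ?Q" "(machine \<sigma> p, slot p) = (machine \<sigma> q, slot q)" "p \<noteq> q"
    have "start \<sigma> p < start \<sigma> q + 1 / real L" "start \<sigma> q < start \<sigma> p + 1 / real L"
      using slot[OF pq(1)] slot[OF pq(2)] pq(3) \<open>1 \<le> L\<close> by (auto simp: field_simps)
    then have "max (start \<sigma> p) (start \<sigma> q) \<in>
       {start \<sigma> p ..< completion J \<sigma> p} \<inter> {start \<sigma> q ..< completion J \<sigma> q}"
      using Q(3)[OF pq(1)] Q(3)[OF pq(2)] \<open>1 \<le> L\<close> by (auto simp: max_def)
    then show False using disj[of p q] pq Q(1)[OF pq(1)] Q(1)[OF pq(2)] by auto
  qed
  moreover have "(\<lambda>j. (machine \<sigma> j, slot j)) ` ?Q \<subseteq> ({..<m} - machine \<sigma> ` K) \<times> {..<i}"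
  proof clarify
    fix j assume "j \<in> {m..<m + m * i}" "completion J \<sigma> j \<le> t + real i / real L"
    then have j: "j \<in> ?Q" by simp
    have "(start \<sigma> j + 1 / real L) * real L \<le> (t + real i / real L) * real L"
      using Q(4)[OF j] by (intro mult_right_mono) auto
    \<comment> \<open>The summand 1 is the job's own size in grid units; it leaves only the slots
      below \<open>i\<close>.\<close>
    then have "(start \<sigma> j - t) * real L + 1 \<le> real i"
      using \<open>1 \<le> L\<close> by (simp add: left_diff_distrib distrib_right)
    then have "slot j < i" using slot(1)[OF j] by linarith
    moreover have "machine \<sigma> j \<notin> machine \<sigma> ` K"
    proof
      assume "machine \<sigma> j \<in> machine \<sigma> ` K"
      then obtain p where p: "p \<in> K" "machine \<sigma> p = machine \<sigma> j" by auto
      \<comment> \<open>As \<open>i \<le> L\<close>, job \<open>j\<close> starts before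
        \<open>t + 1\<close>, while job \<open>p\<close> of \<open>K\<close> is still
        running.\<close>
      have "real i / real L \<le> 1" using assms by simp
      moreover have "0 < 1 / real L" using \<open>1 \<le> L\<close> by simp
      ultimately have "start \<sigma> p \<le> start \<sigma> j" "start \<sigma> j < completion J \<sigma> p"
        "start \<sigma> j < completion J \<sigma> j"
        using K(2)[OF p(1)] compK(1)[OF p(1)] Q(2-4)[OF j] by linarith+
      then have "start \<sigma> j \<in> {start \<sigma> p ..< completion J \<sigma> p} \<inter> {start \<sigma> j ..< completion J \<sigma> j}"
        by simp
      moreover have "p \<noteq> j" using p(1) K(1) j by auto
      ultimately show False using disj[of p j] p compK(2)[OF p(1)] Q(1)[OF j] by blast
    qed
    ultimately show "(machine \<sigma> j \<in> {..<m} - machine \<sigma> ` K) \<and> slot j \<in> {..<i}"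
      using mach Q(1)[OF j] by auto
  qed
  ultimately have "card ?Q \<le> card (({..<m} - machine \<sigma> ` K) \<times> {..<i})"
    by (intro card_inj_on_le[where f = "\<lambda>j. (machine \<sigma> j, slot j)"]) auto
  also have "\<dots> = (m - card K) * i"
    using KM injK by (simp add: card_cartesian_product card_Diff_subset card_image finite_subset)
  finally show ?thesis .
qed

text \<open>Double counting of the pairs \<open>(i, j)\<close> in which job \<open>j\<close> of the
  first \<open>i\<close> rounds is unfinished at \<open>t + i / L\<close>. Of the
  \<open>m * i\<close> jobs arrived, at most \<open>(m - card K) * i\<close> are done, which leaves
  \<open>card K * i\<close> pairs for each \<open>i\<close>. A job lies in at most \<open>L\<close>
  times its flow time many pairs. Summing over \<open>i\<close> and cancelling \<open>L\<close>
  gives the bound.\<close>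

lemma stream_instance_expensive:
  assumes J: "J = stream_instance n m D L t" and inst: "J \<in> instances n" and f: "feasible m J \<sigma>"
    and "1 \<le> m" "1 \<le> L" "m + m * L \<le> n"
    and K: "K \<subseteq> {..<m}" "\<And>j. j \<in> K \<Longrightarrow> start \<sigma> j \<le> t \<and> t + 1 \<le> start \<sigma> j + 3"
  shows "real (card K) * (real L + 1) / 2 \<le> total_flow_time J \<sigma>"
proof -
  let ?S = "{m..<m + m * L}"
  define R where "R i j \<longleftrightarrow> j < m + m * i \<and> t + real i / real L < completion J \<sigma> j" for i j
  have kM: "card K \<le> m" using K(1) card_mono[of "{..<m}" K] by simp
  have row: "card K * i \<le> card {j\<in>?S. R i j}" if "i \<in> {1..L}" for i
  proof -
    let ?Q = "{j\<in>{m..<m + m * i}. completion J \<sigma> j \<le> t + real i / real L}"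
    have iL: "m * i \<le> m * L" using that by simp
    then have "j < m + m * L" if "j < m + m * i" for j using that by linarith
    then have "{m..<m + m * i} = {j\<in>?S. R i j} \<union> ?Q"
      by (auto simp: R_def)
    then have "card {m..<m + m * i} \<le> card {j\<in>?S. R i j} + card ?Q"
      by (metis card_Un_le)
    moreover have "card ?Q \<le> (m - card K) * i"
      using that assms by (intro stream_completed_bound[OF J f]) auto
    moreover have "m * i = (m - card K) * i + card K * i"
      using kM by (simp flip: add_mult_distrib)
    ultimately show ?thesis by simp
  qed
  have col: "real (card {i\<in>{1..L}. R i j}) \<le> real L * (completion J \<sigma> j - release (J ! j))"
    if "j \<in> ?S" for j
  proof -
    have j: "m \<le> j" "j < m + m * L" "j < n" using that assms by auto
    note b = round_bounds[OF j(1,2) \<open>1 \<le> m\<close>]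
    have r: "release (J ! j) = t + (real (j div m) - 1) / real L"
      using j by (simp add: J arrival_def)
    \<comment> \<open>A job of round \<open>r\<close> arrives at grid time \<open>r - 1\<close>, so
      it is counted only at grid times after \<open>r - 1\<close> and before its completion. The
      subtraction on naturals is exact since \<open>r \<ge> 1\<close>.\<close>
    have "{i\<in>{1..L}. R i j} \<subseteq> {i. j div m - 1 < i \<and>
        real i < real (j div m - 1) + real L * (completion J \<sigma> j - release (J ! j))}"
    proof safe
      fix i assume i: "i \<in> {1..L}" "R i j"
      have "j < Suc i * m" using i by (simp add: R_def algebra_simps)
      then have "j div m < Suc i" by (rule less_mult_imp_div_less)
      then show "j div m - 1 < i" using b by linarith
      show "real i < real (j div m - 1) + real L * (completion J \<sigma> j - release (J ! j))"
      proof -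
        have "real L * (t + real i / real L) < real L * completion J \<sigma> j"
          using i(2) b by (intro mult_strict_left_mono) (auto simp: R_def)
        moreover have "real L * (real i / real L) = real i"
          "real L * ((real (j div m) - 1) / real L) = real (j div m - 1)"
          using b by (simp_all add: of_nat_diff)
        ultimately show ?thesis
          unfolding r right_diff_distrib distrib_left by linarith
      qed
    qed
    moreover have "finite {i. j div m - 1 < i \<and>
        real i < real (j div m - 1) + real L * (completion J \<sigma> j - release (J ! j))}"
    proof (rule finite_subset)
      show "{i. j div m - 1 < i \<and>
        real i < real (j div m - 1) + real L * (completion J \<sigma> j - release (J ! j))}
        \<subseteq> {..nat \<lceil>real (j div m - 1) + real L * (completion J \<sigma> j - release (J ! j))\<rceil>}"
        by (auto, linarith)
    qed simp
    ultimately have "card {i\<in>{1..L}. R i j} \<le> card {i. j div m - 1 < i \<and>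
        real i < real (j div m - 1) + real L * (completion J \<sigma> j - release (J ! j))}"
      by (intro card_mono)
    also have "real \<dots> \<le> real L * (completion J \<sigma> j - release (J ! j))"
      using flow_time_nonneg[OF inst f j(3)] by (intro card_less_between) simp
    finally show ?thesis by simp
  qed
  have "real (card K) * (real L * (real L + 1) / 2) = (\<Sum>i=1..L. real (card K * i))"
  proof -
    have "(\<Sum>i=1..L. real i) = real L * (real L + 1) / 2"
      by (induction L) (auto simp: field_simps)
    then show ?thesis by (simp flip: sum_distrib_left)
  qed
  also have "\<dots> \<le> (\<Sum>i=1..L. real (card {j\<in>?S. R i j}))"
    using row by (intro sum_mono) (simp only: of_nat_le_iff)
  also have "\<dots> = (\<Sum>j\<in>?S. real (card {i\<in>{1..L}. R i j}))"
    using sum_multicount_gen[of ?S "{1..L}" "\<lambda>j i. R i j" "\<lambda>i. card {j\<in>?S. R i j}"]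
    by (simp flip: of_nat_sum)
  also have "\<dots> \<le> (\<Sum>j\<in>?S. real L * (completion J \<sigma> j - release (J ! j)))"
    using col by (rule sum_mono)
  also have "\<dots> \<le> real L * total_flow_time J \<sigma>"
  proof -
    have "?S \<subseteq> {..<n}" using \<open>m + m * L \<le> n\<close> by auto
    from total_flow_time_ge_sum[OF inst f this] show ?thesis
      unfolding sum_distrib_left[symmetric] by (rule mult_left_mono) simp
  qed
  finally have "real L * (real (card K) * (real L + 1) / 2) \<le> real L * total_flow_time J \<sigma>"
    by (simp add: algebra_simps)
  then show ?thesis using \<open>1 \<le> L\<close> by simp
qed

section \<open>The adversary\<close>

text \<open>The offline cost is at most \<open>8 * m\<close> in both cases. Late starts cost
  \<open>T * m / 2\<close>, hence the ratio \<open>T / 16\<close>. Otherwise the stream costs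
  \<open>k * (n div m) / 2\<close> with \<open>k\<close> blocked machines, and
  \<open>n div m\<close> is at least \<open>n / (2 * m)\<close>, hence
  \<open>k * n / (32 * m * m)\<close>.\<close>

lemma lower_bound_dichotomy:
  assumes A: "online_algorithm n m A" and m: "1 \<le> m" and n: "2 * m \<le> n" and T: "1 \<le> T"
    and \<rho>: "0 \<le> \<rho>" "\<rho> \<le> real T / 16"
      "\<rho> \<le> max 1 (real m / (2 * real T)) * real n / (32 * (real m)\<^sup>2)"
  shows "competitive_ratio_at_least n m A \<rho>"
proof -
  \<comment> \<open>One value that suits every \<open>g < T\<close>: both
    \<open>g + 3 \<le> D\<close> and \<open>6 \<le> D\<close>.\<close>
  define D where "D = real T + 6"
  define J0 where "J0 = stream_instance n m D 0 2"
  have n1: "1 \<le> n" "m \<le> n" using m n by auto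
  have J0: "J0 \<in> instances n"
    unfolding J0_def using m n1 by (intro stream_instance_in_instances) (auto simp: D_def)
  have f: "feasible m J (A J)" if "J \<in> instances n" for J
    using A that by (simp add: online_algorithm_def)
  define st where "st j = start (A J0) j" for j
  have st0: "0 \<le> st j" if "j < m" for j
  proof -
    have "release (J0 ! j) \<le> st j" using f[OF J0] that n1 by (simp add: feasible_def st_def J0_def)
    then show ?thesis using that n1 by (simp add: J0_def arrival_def)
  qed
  define late where "late = {j\<in>{..<m}. real T \<le> st j}"
  define early where "early = {j\<in>{..<m}. st j < real T}"
  have cards: "card late + card early = m"
  proof -
    have "late \<union> early = {..<m}" "late \<inter> early = {}" by (auto simp: late_def early_def)
    then show ?thesis by (metis card_Un_disjoint card_lessThan finite_Un finite_lessThan)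
  qed
  show ?thesis
  proof (cases "m \<le> 2 * card late")
    case True
    obtain \<sigma> where \<sigma>: "feasible m J0 \<sigma>" "total_flow_time J0 \<sigma> \<le> 8 * real m"
      using stream_instance_cheap[of m 0 n 2 D] m n1 unfolding J0_def by (auto simp: D_def)
    have "\<rho> * (8 * real m) \<le> real T / 16 * (8 * real m)"
      using \<rho> by (intro mult_right_mono) auto
    also have "\<dots> = real T * (real m / 2)" by simp
    also have "\<dots> \<le> real T * real (card late)" using True by (intro mult_left_mono) linarith+
    also have "\<dots> = (\<Sum>j\<in>late. real T)" by simp
    also have "\<dots> \<le> (\<Sum>j\<in>late. completion J0 (A J0) j - release (J0 ! j))"
      using n1 by (intro sum_mono)
        (auto simp: late_def st_def completion_def J0_def arrival_def work_def)
    also have "\<dots> \<le> total_flow_time J0 (A J0)"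
      using n1 by (intro total_flow_time_ge_sum[OF J0 f[OF J0]]) (auto simp: late_def)
    finally show ?thesis by (rule competitive_ratioI[OF J0 \<sigma> \<rho>(1)])
  next
    case False
    define K where "K g = {j\<in>{..<m}. real g \<le> st j \<and> st j < real g + 1}" for g :: nat
    have "early \<subseteq> (\<Union>g<T. K g)"
    proof
      fix j assume j: "j \<in> early"
      then have "0 \<le> st j" "st j < real T" using st0 by (auto simp: early_def)
      then have "real (nat \<lfloor>st j\<rfloor>) \<le> st j" "st j < real (nat \<lfloor>st j\<rfloor>) + 1" by auto
      moreover from this \<open>st j < real T\<close> have "nat \<lfloor>st j\<rfloor> < T" by linarith
      ultimately show "j \<in> (\<Union>g<T. K g)" using j unfolding K_def early_def by blast
    qed
    moreover have "finite (\<Union>g<T. K g)" by (auto simp: K_def)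
    ultimately have "card early \<le> card (\<Union>g<T. K g)" by (simp add: card_mono)
    also have "\<dots> \<le> (\<Sum>g<T. card (K g))" by (rule card_UN_le) simp
    finally have earlyle: "card early \<le> (\<Sum>g<T. card (K g))" .
    \<comment> \<open>Pigeonhole: more than \<open>m / 2\<close> early starts fall into
      \<open>T\<close> unit intervals.\<close>
    have "\<exists>g<T. real m / (2 * real T) \<le> real (card (K g))"
    proof (rule ccontr)
      assume "\<not> ?thesis"
      then have "(\<Sum>g<T. real (card (K g))) < (\<Sum>g<T. real m / (2 * real T))"
        using T by (intro sum_strict_mono) (auto simp: not_le lessThan_empty_iff)
      then show False using earlyle cards False T by (simp flip: of_nat_sum)
    qed
    then obtain g where g: "g < T" "real m / (2 * real T) \<le> real (card (K g))" by blast
    have "0 < real m / (2 * real T)" using m T by simp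
    with g(2) have "0 < real (card (K g))" by linarith
    \<comment> \<open>Integrality supplies the bound 1, which is the better one when
      \<open>m < 2 * T\<close>.\<close>
    then have "1 \<le> real (card (K g))" by simp
    with g(2) have k: "max 1 (real m / (2 * real T)) \<le> real (card (K g))"
      by (rule max.boundedI[rotated])
    \<comment> \<open>The largest number of full rounds that fits into \<open>n\<close> jobs next to
      the \<open>m\<close> long ones.\<close>
    define L where "L = n div m - 1"
    \<comment> \<open>Jobs of \<open>K g\<close> start in \<open>[g, g + 1)\<close> and have size 3,
      so they run at least until \<open>g + 3\<close>, the end of the stream.\<close>
    define t where "t = real g + 2"
    define J1 where "J1 = stream_instance n m D L t"
    have nm: "2 \<le> n div m" using n m by (simp add: less_eq_div_iff_mult_less_eq)
    then have L: "1 \<le> L" "real L + 1 = real (n div m)" by (auto simp: L_def of_nat_diff)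
    have "m + m * L = m * (n div m)" using nm by (simp add: L_def diff_mult_distrib2)
    then have mL: "m + m * L \<le> n" by simp
    have tD: "t + 1 \<le> D" using g by (simp add: t_def D_def)
    have t23: "t = 2 \<or> 3 \<le> t" by (cases g) (auto simp: t_def)
    have J1: "J1 \<in> instances n"
      unfolding J1_def using m n1 tD by (intro stream_instance_in_instances) (auto simp: t_def)
    obtain \<sigma> where \<sigma>: "feasible m J1 \<sigma>" "total_flow_time J1 \<sigma> \<le> 8 * real m"
      using stream_instance_cheap[OF m mL t23 tD] unfolding J1_def by (auto simp: D_def)
    \<comment> \<open>The two instances differ only after time \<open>g + 1\<close>, by which the jobs in \<open>K g\<close> are running.\<close>
    have same: "start (A J1) j = st j" if "j \<in> K g" for j
    proof -
      have j: "j < m" "0 \<le> st j" "st j < real g + 1" using that st0 by (auto simp: K_def)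
      then have "released_by (st j) J0 = released_by (st j) J1"
        unfolding J0_def J1_def using tD m
        by (subst (1 2) released_by_stream_instance) (auto simp: t_def)
      then show ?thesis
        using A J0 J1 j(1) n1 unfolding online_algorithm_def st_def
        by (meson order.refl order.strict_trans2)
    qed
    have "real (card (K g)) * (real L + 1) / 2 \<le> total_flow_time J1 (A J1)"
    proof (rule stream_instance_expensive[OF J1_def J1 f[OF J1] m L(1) mL])
      show "K g \<subseteq> {..<m}" by (auto simp: K_def)
      show "start (A J1) j \<le> t \<and> t + 1 \<le> start (A J1) j + 3" if "j \<in> K g" for j
        using same[OF that] that by (auto simp: K_def t_def)
    qed
    moreover have "\<rho> * (8 * real m) \<le> real (card (K g)) * (real L + 1) / 2"
    proof -
      \<comment> \<open>Rounding \<open>n\<close> down to a multiple of \<open>m\<close> loses at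
        most a factor 2.\<close>
      have "n < m * (n div m) + m"
        using m by (metis add.commute add_less_cancel_left mod_less_divisor
            mult_div_mod_eq less_eq_Suc_le One_nat_def)
      moreover have "m * 2 \<le> m * (n div m)" using nm by simp
      ultimately have "n \<le> 2 * (m * (n div m))" by linarith
      then have "real n \<le> real (2 * (m * (n div m)))" by (simp only: of_nat_le_iff)
      then have nd: "real n / (2 * real m) \<le> real (n div m)"
        using m by (simp add: divide_le_eq algebra_simps)
      have "\<rho> * (8 * real m) \<le> max 1 (real m / (2 * real T)) * real n / (32 * (real m)\<^sup>2) * (8 * real m)"
        using \<rho> by (intro mult_right_mono) auto
      also have "\<dots> = max 1 (real m / (2 * real T)) * (real n / (2 * real m)) / 2"
        using m by (simp add: power2_eq_square)
      also have "\<dots> \<le> real (card (K g)) * real (n div m) / 2"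
        using k nd by (intro divide_right_mono mult_mono) auto
      finally show ?thesis using L by simp
    qed
    ultimately show ?thesis using competitive_ratioI[OF J1 \<sigma> \<rho>(1), of A] by linarith
  qed
qed

section \<open>Choice of the threshold and the constant\<close>

theorem mainTheorem6:
  "\<exists>\<Gamma> :: nat \<Rightarrow> nat \<Rightarrow> real.
     (\<exists>c>0. \<forall>n\<ge>1. \<forall>m\<ge>1. \<Gamma> n m \<ge> c * (real n / (real m)\<^sup>2 + sqrt (real n / real m))) \<and>
     (\<forall>n\<ge>1. \<forall>m\<ge>1. \<forall>A. online_algorithm n m A \<longrightarrow> competitive_ratio_at_least n m A (\<Gamma> n m))"
proof -
  \<comment> \<open>The sum of the two terms is at most twice their maximum \<open>R\<close>, and
    \<open>R / 128\<close> is what the weakest case below yields.\<close>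
  define \<Gamma> where "\<Gamma> n m = 1/256 * (real n / (real m)\<^sup>2 + sqrt (real n / real m))" for n m :: nat
  have "competitive_ratio_at_least n m A (\<Gamma> n m)"
    if n: "1 \<le> n" and m: "1 \<le> m" and A: "online_algorithm n m A" for n m A
  proof -
    define x where "x = real n / (real m)\<^sup>2"
    define y where "y = sqrt (real n / real m)"
    have xy: "0 < x" "0 < y" using n m by (auto simp: x_def y_def)
    have y2: "y * y = real n / real m" using n m by (simp add: y_def)
    have G: "\<Gamma> n m = (x + y) / 256" by (simp add: \<Gamma>_def x_def y_def)
    show ?thesis
    proof (cases "2 * m \<le> n")
      case True
      define R where "R = max x y"
      have "1 \<le> real n / real m" using True m by simp
      then have "1 \<le> y" by (simp add: y_def)
      then have R1: "1 \<le> R" by (simp add: R_def)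
      define T where "T = nat \<lceil>R\<rceil>"
      \<comment> \<open>Rounding up at most doubles \<open>R\<close>, because
        \<open>R \<ge> 1\<close>.\<close>
      have T: "1 \<le> T" "R \<le> real T" "real T \<le> 2 * R" using R1 unfolding T_def by linarith+
      have GR: "\<Gamma> n m \<le> R / 128" by (simp add: G R_def max_def)
      show ?thesis
      proof (rule lower_bound_dichotomy[OF A m True T(1)])
        show "0 \<le> \<Gamma> n m" using xy by (simp add: G)
        show "\<Gamma> n m \<le> real T / 16" using GR T R1 by linarith
        show "\<Gamma> n m \<le> max 1 (real m / (2 * real T)) * real n / (32 * (real m)\<^sup>2)"
        proof (cases "y \<le> x")
          case True
          then have "\<Gamma> n m \<le> 1 * (x / 32)" using GR xy by (simp add: R_def)
          also have "\<dots> \<le> max 1 (real m / (2 * real T)) * (x / 32)"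
            using xy by (intro mult_right_mono) auto
          finally show ?thesis by (simp add: x_def)
        next
          case False
          then have Ry: "R = y" by (simp add: R_def)
          \<comment> \<open>Here \<open>T \<le> 2 * y\<close> makes \<open>m / (2 * T)\<close> at
            least \<open>m / (4 * y)\<close>, and \<open>m * x = y * y\<close>.\<close>
          have "\<Gamma> n m \<le> y * y / (128 * y)" using GR Ry xy by simp
          also have "\<dots> = real m / (4 * y) * (x / 32)"
            unfolding y2 using m xy by (simp add: x_def power2_eq_square)
          also have "\<dots> \<le> real m / (2 * real T) * (x / 32)"
            using T Ry xy by (intro mult_right_mono divide_left_mono) auto
          also have "\<dots> \<le> max 1 (real m / (2 * real T)) * (x / 32)"
            using xy by (intro mult_right_mono) auto
          finally show ?thesis by (simp add: x_def)
        qed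
      qed
    next
      case False
      have q: "real n / real m \<le> 2" using False m by (simp add: divide_le_eq)
      have "x \<le> real n / real m"
        unfolding x_def power2_eq_square using m by (intro divide_left_mono) auto
      moreover have "y \<le> 2"
        unfolding y_def using q by (intro real_le_lsqrt) auto
      ultimately have G1: "\<Gamma> n m \<le> 1" "0 \<le> \<Gamma> n m" using q xy by (auto simp: G)
      \<comment> \<open>With fewer than \<open>2 * m\<close> jobs the claimed ratio is at most 1, so
        any instance works, with the algorithm's own schedule as the bound on the optimum.\<close>
      define J where "J = replicate n (Job 0 1)"
      have J: "J \<in> instances n" by (auto simp: J_def instances_def)
      then have f: "feasible m J (A J)" using A by (simp add: online_algorithm_def)
      have "0 \<le> total_flow_time J (A J)"
        using total_flow_time_ge_sum[OF J f, of "{}"] by simp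
      then have "\<Gamma> n m * total_flow_time J (A J) \<le> total_flow_time J (A J)"
        using G1 by (simp add: mult_left_le_one_le)
      then show ?thesis by (rule competitive_ratioI[OF J f order.refl G1(2)])
    qed
  qed
  moreover have "\<forall>n\<ge>1. \<forall>m\<ge>1. \<Gamma> n m \<ge> 1/256 * (real n / (real m)\<^sup>2 + sqrt (real n / real m))"
    by (simp add: \<Gamma>_def)
  ultimately show ?thesis
    by (intro exI[of _ \<Gamma>] conjI exI[of _ "1/256"]) auto
qed

end
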